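(* Let $\Lambda=\{(\lambda_i,m_i)\}_{i=1}^q\subset\mathbb{R}\times\mathbb{Z}_+$ be a spectrum (eigenvalue-multiplicity pairs) with $\sum_{i=1}^q m_i=n$, and let $\mathcal{E}=\{X\in\mathbb{S}^n : \mathrm{Tr}(C_kX)=b_k,\ k=1,\dots,\ell\}$ be an affine space, where $C_1,\dots,C_\ell\in\mathbb{S}^n$ and $b_1,\dots,b_\ell\in\mathbb{R}$. Let $\mathcal{R}_1(\Lambda,\mathcal{E})$, $\mathcal{I}_1$ and $\Sigma$ be the sets associated with these data that are defined in the context. Then exactly one of the following two statements is true: (1) $\mathcal{R}_1(\Lambda,\mathcal{E})$ is nonempty; (2) $-1\in\mathcal{I}_1+\Sigma$, where $-1$ denotes the constant polynomial and $\mathcal{I}_1+\Sigma=\{f+p : f\in\mathcal{I}_1,\ p\in\Sigma\}$.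
   Context: $\mathbb{S}^n$ is the space of $n\times n$ real symmetric matrices, $I$ is the $n\times n$ identity, and $Z\succeq 0$ means that $Z$ is positive semidefinite. Multiplicities $m_i\in\mathbb{Z}_+$ are positive integers. Polynomials. Let $Z_1,\dots,Z_q$ be symmetric $n\times n$ matrices of indeterminates (the independent indeterminates being the entries $(Z_i)_{s,t}$ with $1\le s\le t\le n$, $1\le i\le q$). Let $\mathbb{R}[Z]$ be the ring of real polynomials in all these indeterminates. Let $\Sigma\subset\mathbb{R}[Z]$ be the set of polynomials that are finite sums of squares of elements of $\mathbb{R}[Z]$. Define the following (scalar or symmetric-matrix valued) polynomials: - $f_1=\sum_{i=1}^q Z_i-I$; - $f_2^{(i)}=\mathrm{Tr}(Z_i)-m_i$ for $i=1,\dots,q$; - $f_3^{(i)}=Z_i^2-Z_i$ for $i=1,\dots,q$; - $f_4^{(k)}=\sum_{i=1}^q\lambda_i\mathrm{Tr}(Z_iC_k)-b_k$ for $k=1,\dots,\ell$. Truncated ideal with constant coefficients: $$\mathcal{I}_1=\Big\{\mathrm{Tr}(h_1f_1)+\sum_{i=1}^q\big[h_2^{(i)}f_2^{(i)}+\mathrm{Tr}(h_3^{(i)}f_3^{(i)})\big]+\sum_{k=1}^\ell h_4^{(k)}f_4^{(k)} \ :\ h_2^{(i)},h_4^{(k)}\in\mathbb{R},\ h_1,h_3^{(i)}\in\mathbb{S}^n \text{ for all } i,k\Big\},$$ where the coefficients $h_1,h_2^{(i)},h_3^{(i)},h_4^{(k)}$ are constants, i.e. do not depend on the variables $Z_1,\dots,Z_q$.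 Relaxation: $$\mathcal{R}_1(\Lambda,\mathcal{E})=\Big\{(Z_1,\dots,Z_q)\in(\mathbb{S}^n)^q \ :\ \sum_{i=1}^qZ_i=I;\ \mathrm{Tr}(Z_i)=m_i,\ Z_i\succeq0\ \ \forall i;\ \ \mathrm{Tr}\Big(\sum_{i=1}^q\lambda_iZ_iC_k\Big)=b_k\ \ \forall k\Big\}.$$ *)

theory Defs
  imports
    "HOL-Analysis.Analysis"
    "HOL-Library.Poly_Mapping"
    "HOL-Library.Uprod"
    "HOL-Library.Set_Algebras"
begin

definition sym_matrices :: "(real ^ 'n ^ 'n) set" where
  "sym_matrices = {A. transpose A = A}"

definition psd :: "real ^ 'n ^ 'n \<Rightarrow> bool" where
  "psd A \<longleftrightarrow> A \<in> sym_matrices \<and> (\<forall>x. 0 \<le> x \<bullet> (A *v x))"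

text \<open>
  The indeterminate in position (s, t) of the i-th matrix is named by i and the unordered pair
  of s and t, so positions (s, t) and (t, s) share one indeterminate. A polynomial maps
  monomials to coefficients, and a monomial maps indeterminates to exponents, both finitely
  supported.
\<close>

type_synonym ('q, 'n) zpoly = "(('q \<times> 'n uprod) \<Rightarrow>\<^sub>0 nat) \<Rightarrow>\<^sub>0 real"

definition pconst :: "real \<Rightarrow> ('q, 'n) zpoly" where
  "pconst c = Poly_Mapping.single 0 c"

definition pvar :: "'q \<times> 'n uprod \<Rightarrow> ('q, 'n) zpoly" where
  "pvar v = Poly_Mapping.single (Poly_Mapping.single v 1) 1"

definition mconst :: "real ^ 'n ^ 'n \<Rightarrow> ('q, 'n) zpoly ^ 'n ^ 'n" where
  "mconst A = (\<chi> s t. pconst (A $ s $ t))"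

definition Zvar :: "'q \<Rightarrow> ('q, 'n) zpoly ^ 'n ^ 'n" where
  "Zvar i = (\<chi> s t. pvar (i, Upair s t))"

definition SOS :: "('q, 'n) zpoly set" where
  "SOS = {\<Sum>j<N. (g j)\<^sup>2 | (N :: nat) g. True}"

definition f1 :: "('q::finite, 'n::finite) zpoly ^ 'n ^ 'n" where
  "f1 = (\<Sum>i\<in>UNIV. Zvar i) - mat 1"

definition f2 :: "('q \<Rightarrow> nat) \<Rightarrow> 'q \<Rightarrow> ('q, 'n::finite) zpoly" where
  "f2 m i = trace (Zvar i) - pconst (real (m i))"

definition f3 :: "'q \<Rightarrow> ('q, 'n::finite) zpoly ^ 'n ^ 'n" where
  "f3 i = Zvar i ** Zvar i - Zvar i"

definition f4 :: "('q::finite \<Rightarrow> real) \<Rightarrow> (nat \<Rightarrow> real ^ 'n::finite ^ 'n) \<Rightarrow> (nat \<Rightarrow> real) \<Rightarrow> nat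
    \<Rightarrow> ('q, 'n) zpoly" where
  "f4 lam C b k =
     (\<Sum>i\<in>UNIV. pconst (lam i) * trace (Zvar i ** mconst (C k))) - pconst (b k)"

definition I1 :: "('q::finite \<Rightarrow> real) \<Rightarrow> ('q \<Rightarrow> nat) \<Rightarrow> nat
    \<Rightarrow> (nat \<Rightarrow> real ^ 'n::finite ^ 'n) \<Rightarrow> (nat \<Rightarrow> real) \<Rightarrow> ('q, 'n) zpoly set" where
  "I1 lam m l C b =
     {trace (mconst h1 ** f1)
       + (\<Sum>i\<in>UNIV. pconst (h2 i) * f2 m i + trace (mconst (h3 i) ** f3 i))
       + (\<Sum>k = 1..l. pconst (h4 k) * f4 lam C b k)
      | h1 h2 h3 h4. h1 \<in> sym_matrices \<and> (\<forall>i. h3 i \<in> sym_matrices)}"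

definition R1 :: "('q::finite \<Rightarrow> real) \<Rightarrow> ('q \<Rightarrow> nat) \<Rightarrow> nat
    \<Rightarrow> (nat \<Rightarrow> real ^ 'n::finite ^ 'n) \<Rightarrow> (nat \<Rightarrow> real) \<Rightarrow> ('q \<Rightarrow> real ^ 'n ^ 'n) set" where
  "R1 lam m l C b =
     {Z. (\<forall>i. Z i \<in> sym_matrices)
       \<and> (\<Sum>i\<in>UNIV. Z i) = mat 1
       \<and> (\<forall>i. trace (Z i) = real (m i) \<and> psd (Z i))
       \<and> (\<forall>k\<in>{1..l}. trace (\<Sum>i\<in>UNIV. lam i *\<^sub>R (Z i ** C k)) = b k)}"

end

theory Submission
  imports Defs
begin

text \<open>
  Given a point \<open>Z\<close> of the relaxation, every \<open>Z i - Z i ** Z i\<close> is positive semidefinite, so there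
  are symmetric perturbations \<open>\<plusminus> U s i\<close> of mean zero whose squares average to it. The average of
  evaluations at \<open>Z i \<plusminus> U s i\<close> then has mean \<open>Z i\<close> and second moment \<open>Z i\<close>: it annihilates \<open>I1\<close>
  and is nonnegative on \<open>SOS\<close>, so \<open>- 1\<close> is not in the sum.

  Conversely, the positive semidefinite tuples of total trace \<open>n\<close> form a compact convex set. If none
  satisfies the linear constraints, separation gives a combination of the constraints that is
  strictly positive on this set. Shifting it by a multiple of the identity turns it into
  \<open>(\<Sum>i. trace (B i ** Z i)) + 1\<close> with every \<open>B i\<close> positive semidefinite. Modulo \<open>f3\<close>,
  \<open>trace (B i ** Z i)\<close> equals \<open>trace (B i ** Z i ** Z i)\<close>, which is a sum of squares.
\<close>

subsection \<open>Polynomials: evaluation, constants and traces\<close>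

definition mon_eval :: "('v \<Rightarrow> real) \<Rightarrow> ('v \<Rightarrow>\<^sub>0 nat) \<Rightarrow> real" where
  "mon_eval a u = (\<Prod>v\<in>Poly_Mapping.keys u. a v ^ Poly_Mapping.lookup u v)"

definition poly_eval :: "('v \<Rightarrow> real) \<Rightarrow> (('v \<Rightarrow>\<^sub>0 nat) \<Rightarrow>\<^sub>0 real) \<Rightarrow> real" where
  "poly_eval a p = (\<Sum>u\<in>Poly_Mapping.keys p. Poly_Mapping.lookup p u * mon_eval a u)"

text \<open>Indeterminates outside the support contribute \<open>a v ^ 0 = 1\<close>. A common index
  set for two monomials is what additivity in the exponent requires.\<close>

lemma mon_eval_superset:
  assumes "finite S" "Poly_Mapping.keys u \<subseteq> S"
  shows "mon_eval a u = (\<Prod>v\<in>S. a v ^ Poly_Mapping.lookup u v)"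
  unfolding mon_eval_def using assms
  by (intro prod.mono_neutral_left) (auto simp: in_keys_iff)

lemma mon_eval_add: "mon_eval a (u + w) = mon_eval a u * mon_eval a w"
proof -
  let ?S = "Poly_Mapping.keys u \<union> Poly_Mapping.keys w"
  have "mon_eval a (u + w) = (\<Prod>v\<in>?S. a v ^ Poly_Mapping.lookup (u + w) v)"
    using keys_add[of u w] by (intro mon_eval_superset) auto
  also have "\<dots> = mon_eval a u * mon_eval a w"
    by (simp add: mon_eval_superset[of ?S] lookup_add power_add prod.distrib)
  finally show ?thesis .
qed

lemma poly_eval_superset:
  assumes "finite S" "Poly_Mapping.keys p \<subseteq> S"
  shows "poly_eval a p = (\<Sum>u\<in>S. Poly_Mapping.lookup p u * mon_eval a u)"
  unfolding poly_eval_def using assms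
  by (intro sum.mono_neutral_left) (auto simp: in_keys_iff)

lemma poly_eval_add: "poly_eval a (p + q) = poly_eval a p + poly_eval a q"
proof -
  let ?S = "Poly_Mapping.keys p \<union> Poly_Mapping.keys q"
  have "poly_eval a (p + q) = (\<Sum>u\<in>?S. Poly_Mapping.lookup (p + q) u * mon_eval a u)"
    using keys_add[of p q] by (intro poly_eval_superset) auto
  also have "\<dots> = poly_eval a p + poly_eval a q"
    by (simp add: poly_eval_superset[of ?S] lookup_add distrib_right sum.distrib)
  finally show ?thesis .
qed

lemma poly_eval_single: "poly_eval a (Poly_Mapping.single u c) = c * mon_eval a u"
  by (simp add: poly_eval_def)

lemma poly_eval_zero [simp]: "poly_eval a 0 = 0"
  by (simp add: poly_eval_def)

lemma poly_eval_sum: "poly_eval a (\<Sum>x\<in>S. f x) = (\<Sum>x\<in>S. poly_eval a (f x))"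
  by (induction S rule: infinite_finite_induct) (auto simp: poly_eval_add)

lemma poly_mapping_sum_single:
  fixes p :: "'k \<Rightarrow>\<^sub>0 'c::comm_monoid_add"
  shows "p = (\<Sum>u\<in>Poly_Mapping.keys p. Poly_Mapping.single u (Poly_Mapping.lookup p u))"
  by (rule poly_mapping_eqI)
     (auto simp: lookup_sum lookup_single when_def in_keys_iff)

text \<open>Expanding both factors into single monomials reduces the claim to
  \<open>mon_eval_add\<close>.\<close>

lemma poly_eval_mult: "poly_eval a (p * q) = poly_eval a p * poly_eval a q"
proof -
  have "p * q = (\<Sum>u\<in>Poly_Mapping.keys p. \<Sum>w\<in>Poly_Mapping.keys q.
      Poly_Mapping.single (u + w) (Poly_Mapping.lookup p u * Poly_Mapping.lookup q w))"
    by (subst poly_mapping_sum_single[of p], subst poly_mapping_sum_single[of q])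
       (simp add: sum_product mult_single)
  then show ?thesis
    by (simp add: poly_eval_sum poly_eval_single mon_eval_add, simp add: poly_eval_def sum_product mult_ac)
qed

lemma poly_eval_uminus: "poly_eval a (- p) = - poly_eval a p"
  using poly_eval_add[of a p "- p"] by simp

lemma poly_eval_diff: "poly_eval a (p - q) = poly_eval a p - poly_eval a q"
  using poly_eval_add[of a p "- q"] by (simp add: poly_eval_uminus)

lemma poly_eval_pconst [simp]: "poly_eval a (pconst c) = c"
  by (simp add: pconst_def poly_eval_single mon_eval_def)

lemma poly_eval_pvar [simp]: "poly_eval a (pvar v) = a v"
  by (simp add: pvar_def poly_eval_single mon_eval_def)

lemma poly_eval_SOS_nonneg: "p \<in> SOS \<Longrightarrow> 0 \<le> poly_eval a p"
  by (auto simp: SOS_def poly_eval_sum power2_eq_square poly_eval_mult intro!: sum_nonneg)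

lemma pconst_simps:
  "pconst 0 = 0" "pconst 1 = 1" "pconst (x + y) = pconst x + pconst y"
  "pconst (x - y) = pconst x - pconst y" "pconst (- x) = - pconst x"
  "pconst (x * y) = pconst x * pconst y"
  by (simp_all add: pconst_def single_add single_diff single_uminus mult_single)

lemma pconst_sum: "pconst (\<Sum>x\<in>S. f x) = (\<Sum>x\<in>S. pconst (f x))"
  by (induction S rule: infinite_finite_induct) (auto simp: pconst_simps)

lemma SOS_sum_squares:
  assumes "finite S"
  shows "(\<Sum>x\<in>S. (g x)\<^sup>2) \<in> SOS"
proof -
  obtain h where h: "bij_betw h {..<card S} S"
    using ex_bij_betw_nat_finite[OF assms] by (auto simp: atLeast0LessThan)
  have "(\<Sum>x\<in>S. (g x)\<^sup>2) = (\<Sum>j<card S. (g (h j))\<^sup>2)"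
    using sum.reindex_bij_betw[OF h, of "\<lambda>x. (g x)\<^sup>2"] by simp
  then show ?thesis
    unfolding SOS_def mem_Collect_eq
    by (intro exI[of _ "card S"] exI[of _ "\<lambda>j. g (h j)"]) simp
qed

section \<open>Traces of matrix products and constant polynomial matrices\<close>

lemma trace_matrix_mult:
  fixes A B :: "'a::comm_semiring_1 ^ 'n ^ 'n"
  shows "trace (A ** B) = (\<Sum>s\<in>UNIV. \<Sum>t\<in>UNIV. A $ s $ t * B $ t $ s)"
  by (simp add: trace_def matrix_matrix_mult_def)

lemma trace_zero [simp]: "trace (0 :: 'a::comm_semiring_1 ^ 'n ^ 'n) = 0"
  by (simp add: trace_def)

lemma trace_mult_simps:
  fixes A B :: "'a::comm_ring_1 ^ 'n ^ 'n"
  shows "trace (A ** (B + D)) = trace (A ** B) + trace (A ** D)"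
    and "trace (A ** (B - D)) = trace (A ** B) - trace (A ** D)"
    and "trace ((A + D) ** B) = trace (A ** B) + trace (D ** B)"
    and "trace ((A - D) ** B) = trace (A ** B) - trace (D ** B)"
    and "trace ((- A) ** B) = - trace (A ** B)"
  by (simp_all add: trace_matrix_mult algebra_simps sum.distrib sum_subtractf sum_negf)

lemma trace_sum_mult:
  fixes A :: "'b \<Rightarrow> 'a::comm_ring_1 ^ 'n ^ 'n"
  shows "trace ((\<Sum>x\<in>S. A x) ** B) = (\<Sum>x\<in>S. trace (A x ** B))"
  by (induction S rule: infinite_finite_induct) (auto simp: trace_mult_simps)

lemma trace_mult_sum:
  fixes A :: "'b \<Rightarrow> 'a::comm_ring_1 ^ 'n ^ 'n"
  shows "trace (B ** (\<Sum>x\<in>S. A x)) = (\<Sum>x\<in>S. trace (B ** A x))"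
  by (induction S rule: infinite_finite_induct) (auto simp: trace_mult_simps)

lemma trace_scaleR_mult: "trace ((c *\<^sub>R A) ** B) = c * trace (A ** B)"
  for A B :: "real ^ 'n ^ 'n"
  by (simp add: trace_matrix_mult sum_distrib_left mult_ac)

lemma trace_mult_scaleR: "trace (B ** (c *\<^sub>R A)) = c * trace (B ** A)"
  for A B :: "real ^ 'n ^ 'n"
  by (simp add: trace_matrix_mult sum_distrib_left mult_ac)

lemma trace_sum: "trace (\<Sum>x\<in>S. A x) = (\<Sum>x\<in>S. trace (A x))"
  for A :: "'b \<Rightarrow> 'a::comm_ring_1 ^ 'n ^ 'n"
  using trace_mult_sum[of "mat 1" A S] by simp

lemma mconst_simps:
  "mconst (A + B) = mconst A + mconst B" "mconst (A - B) = mconst A - mconst B"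
  "mconst (- A) = - mconst A" "mconst 0 = 0" "mconst (mat 1) = mat 1"
  by (auto simp: mconst_def vec_eq_iff pconst_simps mat_def)

lemma mconst_sum: "mconst (\<Sum>x\<in>S. A x) = (\<Sum>x\<in>S. mconst (A x))"
  by (induction S rule: infinite_finite_induct) (auto simp: mconst_simps)

lemma trace_mconst_scaleR: "trace (mconst (c *\<^sub>R A) ** X) = pconst c * trace (mconst A ** X)"
  by (simp add: trace_matrix_mult mconst_def pconst_simps sum_distrib_left mult_ac)

lemma trace_mconst: "trace (mconst A) = pconst (trace A)"
  by (simp add: trace_def mconst_def pconst_sum)

section \<open>Normal form of the elements of the truncated ideal\<close>

definition dual_matrix :: "('q::finite \<Rightarrow> real) \<Rightarrow> nat \<Rightarrow> (nat \<Rightarrow> real ^ 'n::finite ^ 'n)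
    \<Rightarrow> real ^ 'n ^ 'n \<Rightarrow> ('q \<Rightarrow> real) \<Rightarrow> (nat \<Rightarrow> real) \<Rightarrow> 'q \<Rightarrow> real ^ 'n ^ 'n" where
  "dual_matrix lam l C h1 h2 h4 i =
     h1 + h2 i *\<^sub>R mat 1 + (\<Sum>k = 1..l. (h4 k * lam i) *\<^sub>R C k)"

definition dual_value :: "('q::finite \<Rightarrow> nat) \<Rightarrow> nat \<Rightarrow> (nat \<Rightarrow> real)
    \<Rightarrow> real ^ 'n::finite ^ 'n \<Rightarrow> ('q \<Rightarrow> real) \<Rightarrow> (nat \<Rightarrow> real) \<Rightarrow> real" where
  "dual_value m l b h1 h2 h4 =
     trace h1 + (\<Sum>i\<in>UNIV. h2 i * real (m i)) + (\<Sum>k = 1..l. h4 k * b k)"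

text \<open>The multiples of \<open>f1\<close>, \<open>f2\<close> and \<open>f4\<close> are affine
  in the variables. Collecting them gives \<open>dual_matrix\<close> as the coefficient of
  \<open>Zvar i\<close> (the adjoint of the constraint map applied to the multipliers) and
  \<open>dual_value\<close> as the pairing of the multipliers with the right-hand sides.\<close>

lemma I1_normal_form:
  "trace (mconst h1 ** f1)
       + (\<Sum>i\<in>UNIV. pconst (h2 i) * f2 m i + trace (mconst (h3 i) ** f3 i))
       + (\<Sum>k = 1..l. pconst (h4 k) * f4 lam C b k)
   = (\<Sum>i\<in>UNIV. trace (mconst (dual_matrix lam l C h1 h2 h4 i) ** Zvar i)
        + trace (mconst (h3 i) ** f3 i)) - pconst (dual_value m l b h1 h2 h4)"
proof -
  have 1: "(\<Sum>k = 1..l. pconst (h4 k) * f4 lam C b k)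
     = (\<Sum>i\<in>UNIV. \<Sum>k = 1..l. pconst (h4 k * lam i) * trace (mconst (C k) ** Zvar i))
        - pconst (\<Sum>k = 1..l. h4 k * b k)"
    unfolding f4_def
    by (subst sum.swap) (simp add: trace_mul_sym[of "Zvar _"] algebra_simps sum_subtractf pconst_sum 
       pconst_simps sum_distrib_left)
  have 2: "trace (mconst h1 ** f1) = (\<Sum>i\<in>UNIV. trace (mconst h1 ** Zvar i)) - pconst (trace h1)"
    by (simp add: f1_def trace_mult_simps trace_mult_sum trace_mconst)
  have 3: "pconst (h2 i) * f2 m i = pconst (h2 i) * trace (Zvar i) - pconst (h2 i * real (m i))" for i
    by (simp add: f2_def algebra_simps pconst_simps)
  show ?thesis
    unfolding 1 2 3 dual_matrix_def dual_value_def
    by (simp add: mconst_simps mconst_sum trace_mult_simps trace_sum_mult trace_mconst_scaleR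
        sum.distrib sum_subtractf pconst_simps pconst_sum)
qed

subsection \<open>Positive semidefinite matrices\<close>

lemma sym_matrices_component: "A \<in> sym_matrices \<Longrightarrow> A $ s $ t = A $ t $ s"
  by (simp add: sym_matrices_def transpose_def vec_eq_iff)

lemma sym_matricesI: "(\<And>s t. A $ s $ t = A $ t $ s) \<Longrightarrow> A \<in> sym_matrices"
  by (simp add: sym_matrices_def transpose_def vec_eq_iff)

lemma sym_matrices_sum:
  "(\<And>x. x \<in> S \<Longrightarrow> A x \<in> sym_matrices) \<Longrightarrow> (\<Sum>x\<in>S. A x) \<in> sym_matrices"
  by (rule sym_matricesI) (auto intro!: sum.cong sym_matrices_component)

lemma sym_matrices_simps:
  "A \<in> sym_matrices \<Longrightarrow> B \<in> sym_matrices \<Longrightarrow> A + B \<in> sym_matrices"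
  "A \<in> sym_matrices \<Longrightarrow> B \<in> sym_matrices \<Longrightarrow> A - B \<in> sym_matrices"
  "A \<in> sym_matrices \<Longrightarrow> c *\<^sub>R A \<in> sym_matrices"
  "mat 1 \<in> sym_matrices"
  "0 \<in> sym_matrices"
  by (auto intro!: sym_matricesI simp: mat_def sym_matrices_component)

lemma sym_matrices_square: "A \<in> sym_matrices \<Longrightarrow> A ** A \<in> sym_matrices"
  by (simp add: sym_matrices_def matrix_transpose_mul)

lemma trace_mult_inner: "A \<in> sym_matrices \<Longrightarrow> trace (A ** B) = A \<bullet> B"
  unfolding trace_matrix_mult inner_vec_def
  by (subst sum.swap) (simp add: sym_matrices_component)

lemma sym_matrices_inner_mult: "A \<in> sym_matrices \<Longrightarrow> x \<bullet> (A *v y) = (A *v x) \<bullet> y"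
  using dot_lmul_matrix[of x A y] vector_transpose_matrix[of x A] by (simp add: sym_matrices_def)

text \<open>For \<open>r > 0\<close> this is the hypothesis at the minimiser
  \<open>t = - q / r\<close>. For \<open>r = 0\<close> a nonconstant affine function takes negative
  values, and \<open>r < 0\<close> is impossible.\<close>

lemma quadratic_nonneg_discriminant:
  fixes p q r :: real
  assumes "\<And>t. 0 \<le> p + 2 * q * t + r * t\<^sup>2"
  shows "q\<^sup>2 \<le> p * r"
proof (cases "r = 0")
  case True
  have "q = 0"
  proof (rule ccontr)
    assume "q \<noteq> 0"
    \<comment> \<open>At this \<open>t\<close> the affine function takes the value
      \<open>- 1\<close>.\<close>
    then show False using assms[of "- (p + 1) / (2 * q)"] True by (simp add: field_simps)
  qed
  then show ?thesis using True by simp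
next
  case False
  have "0 \<le> r"
  proof (rule ccontr)
    assume r: "\<not> 0 \<le> r"
    \<comment> \<open>Averaging over \<open>t\<close> and \<open>- t\<close> removes the linear
      term; the point chosen next makes the rest equal to
      \<open>p - \<bar>p\<bar> - 1\<close>.\<close>
    have "0 \<le> p + r * t\<^sup>2" for t
      using assms[of t] assms[of "- t"] by simp
    from this[of "sqrt ((\<bar>p\<bar> + 1) / - r)"] r show False
      by (simp add: real_sqrt_pow2 divide_nonneg_neg)
  qed
  with False have r: "0 < r" by simp
  have "0 \<le> r * (p + 2 * q * (- q / r) + r * (- q / r)\<^sup>2)"
    by (rule mult_nonneg_nonneg[OF less_imp_le[OF r] assms])
  also have "\<dots> = p * r - q\<^sup>2" using r by (simp add: field_simps power2_eq_square)
  finally show ?thesis by simp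
qed

text \<open>The quadratic form of \<open>A\<close> at \<open>x + t *\<^sub>R y\<close> is a
  nonnegative quadratic polynomial in \<open>t\<close>.\<close>

lemma psd_Cauchy_Schwarz:
  assumes "psd A"
  shows "(x \<bullet> (A *v y))\<^sup>2 \<le> (x \<bullet> (A *v x)) * (y \<bullet> (A *v y))"
proof (rule quadratic_nonneg_discriminant)
  fix t
  have s: "y \<bullet> (A *v x) = x \<bullet> (A *v y)"
    using assms by (metis psd_def sym_matrices_inner_mult inner_commute)
  have "0 \<le> (x + t *\<^sub>R y) \<bullet> (A *v (x + t *\<^sub>R y))"
    using assms by (simp only: psd_def)
  also have "\<dots> = x \<bullet> (A *v x) + 2 * (x \<bullet> (A *v y)) * t + (y \<bullet> (A *v y)) * t\<^sup>2"
    by (simp add: matrix_vector_right_distrib matrix_scaleR_vector_ac scaleR_matrix_vector_assoc[symmetric] inner_add_left inner_add_right s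
        power2_eq_square algebra_simps)
  finally show "0 \<le> x \<bullet> (A *v x) + 2 * (x \<bullet> (A *v y)) * t + (y \<bullet> (A *v y)) * t\<^sup>2" .
qed

section \<open>Rank-one matrices and decompositions into them\<close>

definition outer :: "real ^ 'n \<Rightarrow> real ^ 'n ^ 'n" where
  "outer x = (\<chi> s t. x $ s * x $ t)"

lemma outer_sym: "outer x \<in> sym_matrices"
  by (simp add: outer_def sym_matricesI mult.commute)

lemma outer_mult_vec: "outer w *v x = (w \<bullet> x) *\<^sub>R w"
proof -
  have "(\<Sum>t\<in>UNIV. w $ s * w $ t * x $ t) = (\<Sum>t\<in>UNIV. w $ t * x $ t) * w $ s" for s
    unfolding sum_distrib_right by (simp add: ac_simps)
  then show ?thesis
    by (simp add: outer_def matrix_vector_mult_def inner_vec_def vec_eq_iff)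
qed

text \<open>Reads a quadratic form as a linear functional of the matrix. This later gives closedness
  of the semidefinite cone and evaluates rank-one test points.\<close>

lemma inner_outer: "A \<bullet> outer x = x \<bullet> (A *v x)"
proof -
  have "(\<Sum>s\<in>UNIV. \<Sum>t\<in>UNIV. A $ s $ t * (x $ s * x $ t)) = (\<Sum>s\<in>UNIV. x $ s * (\<Sum>t\<in>UNIV. A $ s $ t * x $ t))"
    unfolding sum_distrib_left by (intro sum.cong refl) (simp only: mult.left_commute)
  then show ?thesis
    by (simp only: outer_def inner_vec_def matrix_vector_mult_def vec_lambda_beta inner_real_def)
qed

lemma inner_outer_mult_vec: "x \<bullet> (outer w *v x) = (w \<bullet> x)\<^sup>2"
  by (simp add: outer_mult_vec power2_eq_square inner_commute)

lemma psd_outer: "psd (outer x)"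
  unfolding psd_def inner_outer_mult_vec by (simp add: outer_sym)

lemma trace_outer: "trace (outer x) = x \<bullet> x"
  by (simp add: trace_def outer_def inner_vec_def)

lemma inner_axis_mult_axis: "axis s 1 \<bullet> (A *v axis t 1) = A $ s $ t" for A :: "real ^ 'n ^ 'n"
  by (simp only: matrix_vector_mult_basis inner_axis' column_def vec_lambda_beta inner_real_def mult_1)

lemma psd_entry_square: "psd A \<Longrightarrow> (A $ s $ t)\<^sup>2 \<le> A $ s $ s * A $ t $ t"
  using psd_Cauchy_Schwarz[of A "axis s 1" "axis t 1"] by (simp add: inner_axis_mult_axis)

lemma psd_diag_nonneg:
  assumes "psd A"
  shows "0 \<le> A $ s $ s"
proof -
  have "0 \<le> axis s 1 \<bullet> (A *v axis s 1)"
    using assms unfolding psd_def by blast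
  then show ?thesis by (simp only: inner_axis_mult_axis)
qed

text \<open>Gaussian elimination: subtracting \<open>outer w\<close> clears row and column \<open>s\<close>. If the pivot
  vanishes, then so does its whole row, and \<open>w = 0\<close> because \<open>1 / 0 = 0\<close>.\<close>

lemma psd_sum_outer_support:
  assumes "finite S" "psd A" "\<And>s t. s \<notin> S \<Longrightarrow> A $ s $ t = 0"
  shows "\<exists>v. A = (\<Sum>s\<in>S. outer (v s))"
  using assms
proof (induction S arbitrary: A)
  case empty
  have "A = 0" using empty.prems(2) by (simp add: vec_eq_iff)
  then show ?case by simp
next
  case (insert s S)
  define w where "w = (1 / sqrt (A $ s $ s)) *\<^sub>R column s A"
  define B where "B = A - outer w"
  have sym: "A \<in> sym_matrices"
    using insert.prems(1) by (simp add: psd_def)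
  have d: "0 \<le> A $ s $ s"
    using insert.prems(1) by (rule psd_diag_nonneg)
  have row: "A $ s $ t = 0" if "A $ s $ s = 0" for t
    using psd_entry_square[OF insert.prems(1), of s t] that by simp
  have "psd B"
    unfolding psd_def
  proof (intro conjI allI)
    show "B \<in> sym_matrices"
      by (simp add: B_def sym sym_matrices_simps outer_sym)
    fix x
    \<comment> \<open>For a nonzero pivot this is Cauchy-Schwarz for \<open>x\<close> and
      \<open>axis s 1\<close>, divided by the pivot.\<close>
    have "(w \<bullet> x)\<^sup>2 \<le> x \<bullet> (A *v x)"
    proof (cases "A $ s $ s = 0")
      case True
      then show ?thesis using insert.prems(1) by (simp add: w_def psd_def)
    next
      case False
      have "(w \<bullet> x)\<^sup>2 = (x \<bullet> (A *v axis s 1))\<^sup>2 / A $ s $ s"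
        using d by (simp add: w_def matrix_vector_mult_basis power_divide inner_commute)
      also have "\<dots> \<le> x \<bullet> (A *v x)"
        using psd_Cauchy_Schwarz[OF insert.prems(1), of x "axis s 1"] False d
        by (simp add: inner_axis_mult_axis field_simps)
      finally show ?thesis .
    qed
    then show "0 \<le> x \<bullet> (B *v x)"
      by (simp add: B_def matrix_vector_mult_diff_rdistrib inner_outer_mult_vec inner_diff_right)
  qed
  moreover have "B $ s' $ t = 0" if "s' \<notin> S" for s' t
  proof (cases "s' = s")
    case True
    then show ?thesis
      using row[of t] d sym_matrices_component[OF sym, of s t]
      by (cases "A $ s $ s = 0") (auto simp: B_def w_def outer_def column_def real_div_sqrt)
  next
    case False
    \<comment> \<open>Row \<open>s'\<close> of \<open>A\<close> vanishes, in particular its entry in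
      column \<open>s\<close>, hence also \<open>w $ s'\<close>.\<close>
    then show ?thesis
      using insert.prems(2)[of s'] that by (simp add: B_def w_def outer_def column_def)
  qed
  ultimately obtain v where v: "B = (\<Sum>s\<in>S. outer (v s))"
    using insert.IH by blast
  have "(\<Sum>u\<in>S. outer ((v(s := w)) u)) = (\<Sum>u\<in>S. outer (v u))"
    using insert.hyps by (intro sum.cong) auto
  then have "A = (\<Sum>u\<in>insert s S. outer ((v(s := w)) u))"
    using insert.hyps v[unfolded B_def diff_eq_eq] by (simp add: add.commute)
  then show ?case by blast
qed

lemma psd_sum_outer:
  assumes "psd (A :: real ^ 'n::finite ^ 'n)"
  obtains v :: "'n \<Rightarrow> real ^ 'n" where "A = (\<Sum>s\<in>UNIV. outer (v s))"
  using psd_sum_outer_support[of UNIV A] assms by auto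

lemma matrix_vector_mult_sum: "(\<Sum>x\<in>S. A x) *v y = (\<Sum>x\<in>S. A x *v y)"
  by (induction S rule: infinite_finite_induct) (auto simp: matrix_vector_mult_add_rdistrib)

text \<open>Each \<open>Z i\<close> lies between 0 and the identity, so its square is below it. No
  diagonalisation is used: for \<open>y = Z i *v x\<close>, Cauchy-Schwarz bounds
  \<open>(y \<bullet> y)\<^sup>2\<close> by
  \<open>(x \<bullet> (Z i *v x)) * (y \<bullet> (Z i *v y))\<close>, the last factor is at most
  \<open>y \<bullet> y\<close>, and one \<open>y \<bullet> y\<close> cancels.\<close>

lemma psd_partition_minus_square:
  fixes Z :: "'q::finite \<Rightarrow> real ^ 'n::finite ^ 'n"
  assumes psd: "\<And>i. psd (Z i)" and one: "(\<Sum>i\<in>UNIV. Z i) = mat 1"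
  shows "psd (Z i - Z i ** Z i)"
  unfolding psd_def
proof (intro conjI allI)
  have sym: "Z i \<in> sym_matrices" using psd by (simp add: psd_def)
  then show "Z i - Z i ** Z i \<in> sym_matrices"
    by (simp add: sym_matrices_simps sym_matrices_square)
  fix x
  define y where "y = Z i *v x"
  have "y \<bullet> (Z i *v y) \<le> (\<Sum>j\<in>UNIV. y \<bullet> (Z j *v y))"
    using psd by (intro member_le_sum) (auto simp: psd_def)
  also have "\<dots> = y \<bullet> y"
    using arg_cong[OF one, of "\<lambda>M. y \<bullet> (M *v y)"]
    by (simp add: matrix_vector_mult_sum inner_sum_right)
  finally have le: "y \<bullet> (Z i *v y) \<le> y \<bullet> y" .
  have eq: "x \<bullet> (Z i *v y) = y \<bullet> y"
    using sym_matrices_inner_mult[OF sym, of x y] by (simp add: y_def)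
  have "y \<bullet> y \<le> x \<bullet> (Z i *v x)"
  proof (cases "y = 0")
    case True
    then show ?thesis using psd by (simp add: psd_def)
  next
    case False
    have "(y \<bullet> y)\<^sup>2 \<le> (x \<bullet> (Z i *v x)) * (y \<bullet> (Z i *v y))"
      using psd_Cauchy_Schwarz[OF psd, of x i y] eq by simp
    also have "\<dots> \<le> (x \<bullet> (Z i *v x)) * (y \<bullet> y)"
      using le psd by (intro mult_left_mono) (auto simp: psd_def)
    finally show ?thesis using False by (simp add: power2_eq_square)
  qed
  then show "0 \<le> x \<bullet> ((Z i - Z i ** Z i) *v x)"
    using eq by (simp add: matrix_vector_mult_diff_rdistrib inner_diff_right y_def matrix_vector_mul_assoc)
qed

text \<open>Supplies an explicit symmetric square root of a rank-one matrix, from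
  \<open>outer v ** outer v = (v \<bullet> v) *\<^sub>R outer v\<close>. For \<open>v = 0\<close>
  both sides are zero.\<close>

lemma outer_normalized_square:
  "((1 / norm v) *\<^sub>R outer v) ** ((1 / norm v) *\<^sub>R outer v) = outer v"
proof (cases "v = 0")
  case True
  then show ?thesis by (simp add: outer_def vec_eq_iff matrix_matrix_mult_def)
next
  case False
  have "(\<Sum>k\<in>UNIV. v $ s * v $ k * (v $ k * v $ t)) = (\<Sum>k\<in>UNIV. v $ k * v $ k) * (v $ s * v $ t)" for s t
    unfolding sum_distrib_right by (intro sum.cong refl) (simp only: ac_simps)
  then have "outer v ** outer v = (v \<bullet> v) *\<^sub>R outer v"
    by (simp add: outer_def matrix_matrix_mult_def vec_eq_iff inner_vec_def)
  moreover have "1 / norm v * (1 / norm v) * (v \<bullet> v) = 1"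
    using False by (simp add: dot_square_norm power2_eq_square)
  ultimately show ?thesis
    by (simp only: scalar_matrix_assoc[symmetric] matrix_scalar_ac scaleR_scaleR scaleR_one)
qed

subsection \<open>Points of the relaxation exclude certificates\<close>

text \<open>Indeterminates carry unordered pairs, so the entry is selected by a description; it is
  unambiguous for symmetric \<open>Y i\<close>.\<close>

definition matrix_point :: "('q \<Rightarrow> real ^ 'n ^ 'n) \<Rightarrow> 'q \<times> 'n uprod \<Rightarrow> real" where
  "matrix_point Y = (\<lambda>(i, u). THE r. \<exists>s t. u = Upair s t \<and> r = Y i $ s $ t)"

lemma matrix_point_Upair:
  assumes "Y i \<in> sym_matrices"
  shows "matrix_point Y (i, Upair s t) = Y i $ s $ t"
  unfolding matrix_point_def prod.case
  by (rule the_equality) (auto simp: sym_matrices_component[OF assms])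

lemma poly_eval_matrix_point:
  assumes "Y i \<in> sym_matrices"
  shows "poly_eval (matrix_point Y) (trace (mconst A ** Zvar i)) = trace (A ** Y i)"
    and "poly_eval (matrix_point Y) (trace (mconst A ** f3 i)) = trace (A ** (Y i ** Y i - Y i))"
  unfolding trace_matrix_mult
  by (simp_all add: f3_def matrix_matrix_mult_def mconst_def Zvar_def poly_eval_sum
      poly_eval_mult poly_eval_diff matrix_point_Upair[of Y i, OF assms])

lemma sum_trace_dual_matrix:
  "(\<Sum>i\<in>UNIV. trace (dual_matrix lam l C h1 h2 h4 i ** Z i))
     = trace (h1 ** (\<Sum>i\<in>UNIV. Z i)) + (\<Sum>i\<in>UNIV. h2 i * trace (Z i))
       + (\<Sum>k = 1..l. h4 k * (\<Sum>i\<in>UNIV. lam i * trace (C k ** Z i)))"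
proof -
  have "(\<Sum>k = 1..l. h4 k * (\<Sum>i\<in>UNIV. lam i * trace (C k ** Z i)))
      = (\<Sum>i\<in>UNIV. \<Sum>k = 1..l. h4 k * lam i * trace (C k ** Z i))"
    unfolding sum_distrib_left by (subst sum.swap) (simp add: mult.assoc)
  then show ?thesis
    by (simp add: dual_matrix_def trace_mult_simps trace_mult_sum trace_sum_mult trace_scaleR_mult
        sum.distrib)
qed

lemma trace_scaleR: "trace (c *\<^sub>R A) = c * trace A" for A :: "real ^ 'n ^ 'n"
  using trace_scaleR_mult[of c A "mat 1"] by simp

lemma trace_sum_scaleR_mult:
  fixes Z :: "'q::finite \<Rightarrow> real ^ 'n::finite ^ 'n"
  shows "trace (\<Sum>i\<in>UNIV. lam i *\<^sub>R (Z i ** D)) = (\<Sum>i\<in>UNIV. lam i * trace (D ** Z i))"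
  by (simp add: trace_sum trace_scaleR trace_mul_sym[of D])

text \<open>At a feasible point the left side of each linear constraint equals its right side, so
  the affine part of every element of \<open>I1\<close> vanishes there.\<close>

lemma R1_dual_value:
  assumes "Z \<in> R1 lam m l C b"
  shows "(\<Sum>i\<in>UNIV. trace (dual_matrix lam l C h1 h2 h4 i ** Z i)) = dual_value m l b h1 h2 h4"
  using assms unfolding sum_trace_dual_matrix dual_value_def R1_def trace_sum_scaleR_mult by simp

lemma I1_iff:
  "f \<in> I1 lam m l C b \<longleftrightarrow> (\<exists>h1 h2 h3 h4. h1 \<in> sym_matrices \<and> (\<forall>i. h3 i \<in> sym_matrices)
     \<and> f = (\<Sum>i\<in>UNIV. trace (mconst (dual_matrix lam l C h1 h2 h4 i) ** Zvar i)
        + trace (mconst (h3 i) ** f3 i)) - pconst (dual_value m l b h1 h2 h4))"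
  unfolding I1_def I1_normal_form by blast

lemma matrix_mult_distrib:
  fixes A B D :: "'a::comm_ring_1 ^ 'n ^ 'n"
  shows "A ** (B + D) = A ** B + A ** D" "(A + B) ** D = A ** D + B ** D"
    "A ** (B - D) = A ** B - A ** D" "(A - B) ** D = A ** D - B ** D"
  by (simp_all add: matrix_matrix_mult_def vec_eq_iff algebra_simps sum.distrib sum_subtractf)

text \<open>The values of \<open>f\<close> at the tuples \<open>Z i + U s i\<close> and
  \<open>Z i - U s i\<close>, over all \<open>s\<close>, add up to zero, although
  \<open>- 1 = f + p\<close> makes each of them at most \<open>- 1\<close>. These tuples need not be
  feasible; only their moments matter.\<close>

lemma R1_imp_no_certificate:
  fixes Z :: "'q::finite \<Rightarrow> real ^ 'n::finite ^ 'n"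
  assumes Z: "Z \<in> R1 lam m l C b"
  shows "- 1 \<notin> I1 lam m l C b + SOS"
proof
  assume "- 1 \<in> I1 lam m l C b + SOS"
  then obtain f p where f: "f \<in> I1 lam m l C b" and p: "p \<in> SOS" and fp: "- 1 = f + p"
    by (auto elim!: set_plus_elim)
  from f obtain h1 h2 h3 h4 where f_eq: "f = (\<Sum>i\<in>UNIV.
        trace (mconst (dual_matrix lam l C h1 h2 h4 i) ** Zvar i) + trace (mconst (h3 i) ** f3 i))
      - pconst (dual_value m l b h1 h2 h4)"
    unfolding I1_iff by blast
  define G where "G = dual_matrix lam l C h1 h2 h4"
  define d where "d = dual_value m l b h1 h2 h4"
  have symZ: "Z i \<in> sym_matrices" and psdZ: "psd (Z i)" for i
    using Z by (auto simp: R1_def)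
  have "\<exists>v :: 'n \<Rightarrow> real ^ 'n. Z i - Z i ** Z i = (\<Sum>s\<in>UNIV. outer (v s))" for i
  proof -
    have "psd (Z i - Z i ** Z i)"
      using Z psdZ by (intro psd_partition_minus_square) (auto simp: R1_def)
    then show ?thesis
      by (rule psd_sum_outer) blast
  qed
  then obtain v :: "'q \<Rightarrow> 'n \<Rightarrow> real ^ 'n"
    where v: "\<And>i. Z i - Z i ** Z i = (\<Sum>s\<in>UNIV. outer (v i s))" by metis
  define N where "N = real CARD('n)"
  \<comment> \<open>Averaging over \<open>s\<close> divides by \<open>N\<close>. The factor
    \<open>sqrt N\<close> compensates, so that the squares of \<open>U s i\<close> average to
    \<open>Z i - Z i ** Z i\<close>.\<close>
  define U where "U s i = sqrt N *\<^sub>R ((1 / norm (v i s)) *\<^sub>R outer (v i s))" for s i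
  have symU: "U s i \<in> sym_matrices" for s i
    by (simp add: U_def sym_matrices_simps outer_sym)
  have U2: "U s i ** U s i = N *\<^sub>R outer (v i s)" for s i
  proof -
    have "(sqrt N *\<^sub>R A) ** (sqrt N *\<^sub>R A) = N *\<^sub>R (A ** A)" for A :: "real ^ 'n ^ 'n"
      by (simp add: N_def scalar_matrix_assoc[symmetric] matrix_scalar_ac)
    then show ?thesis
      by (simp only: U_def outer_normalized_square)
  qed
  define F where "F Y = (\<Sum>i\<in>UNIV. trace (G i ** Y i) + trace (h3 i ** (Y i ** Y i - Y i))) - d" for Y
  have eval_f: "poly_eval (matrix_point Y) f = F Y" if "\<And>i. Y i \<in> sym_matrices" for Y
    using that by (simp add: f_eq F_def G_def d_def poly_eval_diff poly_eval_sum poly_eval_add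
        poly_eval_matrix_point)
  have F_neg: "F Y \<le> - 1" if "\<And>i. Y i \<in> sym_matrices" for Y
  proof -
    have "poly_eval (matrix_point Y) (- 1) = - 1"
      using poly_eval_pconst[of "matrix_point Y" "- 1"] by (simp add: pconst_simps)
    then show ?thesis
      using eval_f[OF that] poly_eval_SOS_nonneg[OF p, of "matrix_point Y"]
      unfolding fp by (simp add: poly_eval_add)
  qed
  \<comment> \<open>At \<open>Z\<close> the affine part cancels, which leaves the failure of
    \<open>Z i\<close> to be idempotent.\<close>
  have FZ: "F Z = - (\<Sum>s\<in>UNIV. \<Sum>i\<in>UNIV. trace (h3 i ** outer (v i s)))"
  proof -
    have "trace (h3 i ** (Z i ** Z i - Z i)) = - (\<Sum>s\<in>UNIV. trace (h3 i ** outer (v i s)))" for i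
      unfolding trace_mult_sum[symmetric] v[symmetric] by (simp add: trace_mult_simps)
    then show ?thesis
      using R1_dual_value[OF Z, of h1 h2 h4]
      by (subst sum.swap) (simp add: F_def G_def d_def sum_subtractf)
  qed
  \<comment> \<open>Terms linear in \<open>U s i\<close> cancel between the two signs; the quadratic
    ones double.\<close>
  have "F (\<lambda>i. Z i + U s i) + F (\<lambda>i. Z i - U s i)
      = 2 * F Z + 2 * N * (\<Sum>i\<in>UNIV. trace (h3 i ** outer (v i s)))" for s
  proof -
    have "trace (G i ** (Z i + U s i)) + trace (h3 i ** ((Z i + U s i) ** (Z i + U s i) - (Z i + U s i)))
        + (trace (G i ** (Z i - U s i)) + trace (h3 i ** ((Z i - U s i) ** (Z i - U s i) - (Z i - U s i))))
      = 2 * (trace (G i ** Z i) + trace (h3 i ** (Z i ** Z i - Z i)))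
        + 2 * trace (h3 i ** (U s i ** U s i))" for i
      by (simp add: trace_add trace_sub matrix_mult_distrib)
    then show ?thesis
      unfolding F_def by (simp add: sum.distrib[symmetric] sum_distrib_left U2 trace_mult_scaleR algebra_simps)
  qed
  \<comment> \<open>Summation over \<open>s\<close> gives \<open>N\<close> copies of
    \<open>2 * F Z\<close>, and by \<open>FZ\<close> the quadratic terms sum to
    \<open>- 2 * N * F Z\<close>.\<close>
  then have "(\<Sum>s\<in>UNIV. F (\<lambda>i. Z i + U s i) + F (\<lambda>i. Z i - U s i)) = 0"
    by (simp add: sum_subtractf sum_distrib_left[symmetric] FZ N_def)
  moreover have "(\<Sum>s\<in>UNIV. F (\<lambda>i. Z i + U s i) + F (\<lambda>i. Z i - U s i)) < (\<Sum>s\<in>(UNIV :: 'n set). 0)"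
  proof (rule sum_strict_mono)
    fix s
    have "F (\<lambda>i. Z i + U s i) \<le> - 1" "F (\<lambda>i. Z i - U s i) \<le> - 1"
      using symZ symU by (auto intro!: F_neg sym_matrices_simps)
    then show "F (\<lambda>i. Z i + U s i) + F (\<lambda>i. Z i - U s i) < 0" by simp
  qed simp_all
  ultimately show False by simp
qed

subsection \<open>Certificates from separation\<close>

text \<open>A point \<open>z\<close> solves all equations \<open>g \<bullet> z = d\<close> of
  \<open>W\<close> iff \<open>(z, - 1)\<close> is orthogonal to \<open>W\<close>. Hence the
  orthogonal complement of \<open>W\<close> misses \<open>K \<times> {- 1}\<close> and can be
  strictly separated from it. A functional bounded above on a subspace vanishes on it, so the normal
  vector lies in the double complement, which is \<open>W\<close>.\<close>

lemma compact_convex_Farkas: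
  fixes W :: "('a::euclidean_space \<times> real) set"
  assumes W: "subspace W" and K: "compact K" "convex K" "K \<noteq> {}"
    and infeasible: "\<And>z. z \<in> K \<Longrightarrow> \<exists>(g, d)\<in>W. g \<bullet> z \<noteq> d"
  obtains g d c where "(g, d) \<in> W" "0 < c" "\<And>z. z \<in> K \<Longrightarrow> d + c \<le> g \<bullet> z"
proof -
  let ?S = "W\<^sup>\<bottom>" and ?T = "K \<times> {- 1 :: real}"
  have S: "subspace ?S" by (rule subspace_orthogonal_comp)
  have "?S \<inter> ?T = {}"
    using infeasible by (fastforce simp: orthogonal_comp_def orthogonal_def)
  moreover have "convex ?S" "closed ?S" "convex ?T" "compact ?T" "?T \<noteq> {}"
    using S K by (simp_all add: closed_subspace subspace_imp_convex compact_Times convex_Times)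
  ultimately obtain a c where neg: "\<And>x. x \<in> ?S \<Longrightarrow> a \<bullet> x < c" and pos: "\<And>x. x \<in> ?T \<Longrightarrow> c < a \<bullet> x"
    using separating_hyperplane_closed_compact[of ?S ?T] by blast
  have "0 < c"
    using neg[OF subspace_0[OF S]] by simp
  have "a \<bullet> x = 0" if "x \<in> ?S" for x
  proof (rule ccontr)
    assume "a \<bullet> x \<noteq> 0"
    then show False
      \<comment> \<open>The rescaled vector has the value \<open>c\<close>, against the strict
        bound.\<close>
      using neg[OF subspace_scale[OF S that, of "c / (a \<bullet> x)"]] by simp
  qed
  then have "a \<in> ?S\<^sup>\<bottom>"
    by (auto simp: orthogonal_comp_def[of ?S] orthogonal_def inner_commute)
  then have "a \<in> W"
    using orthogonal_comp_self[OF W] by simp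
  moreover have "snd a + c \<le> fst a \<bullet> z" if "z \<in> K" for z
    using pos[of "(z, - 1)"] that by (simp add: inner_prod_def)
  ultimately show thesis
    using \<open>0 < c\<close> by (intro that[of "fst a" "snd a" c]) auto
qed

text \<open>A compact slice of the cone of semidefinite tuples; the trace condition follows from
  \<open>(\<Sum>i\<in>UNIV. Z i) = mat 1\<close>. Tuples are vectors here, not functions as in
  \<open>R1\<close>, so that they form a Euclidean space.\<close>

definition psd_tuples :: "(real ^ 'n::finite ^ 'n ^ 'q::finite) set" where
  "psd_tuples = {z. (\<forall>i. psd (z $ i)) \<and> (\<Sum>i\<in>UNIV. trace (z $ i)) = real CARD('n)}"

lemma closed_psd: "closed {A :: real ^ 'n::finite ^ 'n. psd A}"
proof -
  have "{A :: real ^ 'n ^ 'n. psd A} = {A. \<forall>s t. A $ s $ t = A $ t $ s} \<inter> {A. \<forall>x. 0 \<le> A \<bullet> outer x}"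
    unfolding psd_def by (auto simp: inner_outer sym_matrices_component intro: sym_matricesI)
  also have "closed \<dots>"
    by (intro closed_Int closed_Collect_all closed_Collect_eq closed_Collect_le continuous_intros)
  finally show ?thesis .
qed

text \<open>Rank-one summands have norm equal to trace, so the triangle inequality suffices.\<close>

lemma psd_norm_le_trace:
  fixes A :: "real ^ 'n::finite ^ 'n"
  assumes "psd A"
  shows "norm A \<le> trace A"
proof -
  obtain v :: "'n \<Rightarrow> real ^ 'n" where v: "A = (\<Sum>s\<in>UNIV. outer (v s))"
    using psd_sum_outer[OF assms] by blast
  have "norm (outer x) = x \<bullet> x" for x :: "real ^ 'n"
    using norm_eq_sqrt_inner[of "outer x"] unfolding inner_outer inner_outer_mult_vec by simp
  then show ?thesis
    unfolding v trace_sum trace_outer by (intro order_trans[OF norm_sum]) simp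
qed

lemma compact_psd_tuples: "compact (psd_tuples :: (real ^ 'n::finite ^ 'n ^ 'q::finite) set)"
proof -
  let ?K = "psd_tuples :: (real ^ 'n ^ 'n ^ 'q) set"
  have "?K = (\<Inter>i. (\<lambda>z. z $ i) -` {A. psd A}) \<inter> {z. (\<Sum>i\<in>UNIV. trace (z $ i)) = real CARD('n)}"
    by (auto simp: psd_tuples_def)
  also have "closed \<dots>"
    unfolding trace_def
    by (intro closed_Int closed_INT ballI closed_vimage closed_psd closed_Collect_eq continuous_intros)
  finally have "closed ?K" .
  moreover have "norm z \<le> real CARD('n)" if "z \<in> ?K" for z
  proof -
    have "norm z \<le> (\<Sum>i\<in>UNIV. norm (z $ i))"
      unfolding norm_vec_def by (rule L2_set_le_sum) simp
    also have "\<dots> \<le> (\<Sum>i\<in>UNIV. trace (z $ i))"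
      using that by (intro sum_mono psd_norm_le_trace) (auto simp: psd_tuples_def)
    finally show ?thesis using that by (simp add: psd_tuples_def)
  qed
  then have "bounded ?K" by (auto simp: bounded_iff)
  ultimately show ?thesis by (simp add: compact_eq_bounded_closed)
qed

lemma psd_add: "psd A \<Longrightarrow> psd B \<Longrightarrow> psd (A + B)"
  by (simp add: psd_def sym_matrices_simps matrix_vector_mult_add_rdistrib inner_add_right)

lemma psd_scaleR: "psd A \<Longrightarrow> 0 \<le> c \<Longrightarrow> psd (c *\<^sub>R A)"
  by (simp add: psd_def sym_matrices_simps scaleR_matrix_vector_assoc[symmetric])

lemma convex_psd_tuples: "convex psd_tuples"
  by (rule convexI)
     (auto simp: psd_tuples_def psd_add psd_scaleR trace_add trace_scaleR sum.distrib
       sum_distrib_left[symmetric] distrib_right[symmetric])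

section \<open>From multipliers to certificates\<close>

lemma dual_matrix_linear:
  "dual_matrix lam l C (h1 + h1') (\<lambda>i. h2 i + h2' i) (\<lambda>k. h4 k + h4' k) i
     = dual_matrix lam l C h1 h2 h4 i + dual_matrix lam l C h1' h2' h4' i"
  "dual_matrix lam l C (r *\<^sub>R h1) (\<lambda>i. r * h2 i) (\<lambda>k. r * h4 k) i
     = r *\<^sub>R dual_matrix lam l C h1 h2 h4 i"
  by (simp_all add: dual_matrix_def algebra_simps sum.distrib scaleR_sum_right)

lemma dual_value_linear:
  "dual_value m l b (h1 + h1') (\<lambda>i. h2 i + h2' i) (\<lambda>k. h4 k + h4' k)
     = dual_value m l b h1 h2 h4 + dual_value m l b h1' h2' h4'"
  "dual_value m l b (r *\<^sub>R h1) (\<lambda>i. r * h2 i) (\<lambda>k. r * h4 k) = r * dual_value m l b h1 h2 h4"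
  by (simp_all add: dual_value_def algebra_simps trace_add trace_scaleR sum.distrib sum_distrib_left)

lemma dual_matrix_sym:
  assumes "h1 \<in> sym_matrices" "\<And>k. k \<in> {1..l} \<Longrightarrow> C k \<in> sym_matrices"
  shows "dual_matrix lam l C h1 h2 h4 i \<in> sym_matrices"
  unfolding dual_matrix_def using assms by (intro sym_matrices_simps sym_matrices_sum) auto

text \<open>Suitable multipliers isolate each constraint. Taking \<open>h1\<close> to be the
  symmetric defect \<open>?D\<close> itself gives \<open>?D \<bullet> ?D = 0\<close>; indicator
  functions as \<open>h2\<close> and \<open>h4\<close> give the others.\<close>

lemma R1_if_dual_values:
  fixes Z :: "'q::finite \<Rightarrow> real ^ 'n::finite ^ 'n"
  assumes psd: "\<And>i. psd (Z i)"
    and dual: "\<And>h1 h2 h4. h1 \<in> sym_matrices \<Longrightarrow>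
      (\<Sum>i\<in>UNIV. trace (dual_matrix lam l C h1 h2 h4 i ** Z i)) = dual_value m l b h1 h2 h4"
  shows "Z \<in> R1 lam m l C b"
proof -
  note dual = dual[unfolded sum_trace_dual_matrix dual_value_def]
  have sym: "Z i \<in> sym_matrices" for i
    using psd by (simp add: psd_def)
  let ?D = "(\<Sum>i\<in>UNIV. Z i) - mat 1"
  have D: "?D \<in> sym_matrices"
    by (intro sym_matrices_simps sym_matrices_sum sym)
  have "?D \<bullet> ?D = 0"
    using dual[OF D, of "\<lambda>_. 0" "\<lambda>_. 0"] trace_mult_inner[OF D, of ?D]
    by (simp add: trace_mult_simps(2))
  then have "(\<Sum>i\<in>UNIV. Z i) = mat 1" by simp
  moreover have "trace (Z i) = real (m i)" for i
    using dual[of 0 "\<lambda>j. if j = i then 1 else 0" "\<lambda>_. 0"]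
    by (simp add: sym_matrices_simps if_distrib[of "\<lambda>x. x * _"] sum.delta' cong: if_cong)
  moreover have "trace (\<Sum>i\<in>UNIV. lam i *\<^sub>R (Z i ** C k)) = b k" if "k \<in> {1..l}" for k
    unfolding trace_sum_scaleR_mult using that dual[of 0 "\<lambda>_. 0" "\<lambda>j. if j = k then 1 else 0"]
    by (simp add: sym_matrices_simps if_distrib[of "\<lambda>x. x * _"] cong: if_cong)
  ultimately show ?thesis
    using psd sym by (simp add: R1_def)
qed

lemma psd_tuples_nonempty: "psd_tuples \<noteq> ({} :: (real ^ 'n::finite ^ 'n ^ 'q::finite) set)"
proof -
  let ?z = "(\<chi> i. if i = undefined then mat 1 else 0) :: real ^ 'n ^ 'n ^ 'q"
  have "psd (mat 1 :: real ^ 'n ^ 'n)" "psd (0 :: real ^ 'n ^ 'n)"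
    by (simp_all add: psd_def sym_matrices_simps)
  then have "?z \<in> psd_tuples"
    by (simp add: psd_tuples_def if_distrib[of trace] trace_I cong: if_cong)
  then show ?thesis by blast
qed

text \<open>The image of the multiplier space under a linear map; it is the \<open>W\<close> of the
  separation argument.\<close>

lemma subspace_dual:
  "subspace {((\<chi> i. dual_matrix lam l C h1 h2 h4 i), dual_value m l b h1 h2 h4)
     | h1 h2 h4. h1 \<in> sym_matrices}" (is "subspace ?W")
proof (rule subspaceI)
  show "0 \<in> ?W"
    unfolding mem_Collect_eq
    by (intro exI[of _ 0] exI[of _ "\<lambda>_. 0"])
       (simp add: dual_matrix_def dual_value_def vec_eq_iff zero_prod_def sym_matrices_simps)
next
  fix x y assume "x \<in> ?W" "y \<in> ?W"
  then obtain h1 h2 h4 h1' h2' h4' where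
    x: "x = ((\<chi> i. dual_matrix lam l C h1 h2 h4 i), dual_value m l b h1 h2 h4)" "h1 \<in> sym_matrices" and
    y: "y = ((\<chi> i. dual_matrix lam l C h1' h2' h4' i), dual_value m l b h1' h2' h4')" "h1' \<in> sym_matrices"
    by blast
  have "x + y = ((\<chi> i. dual_matrix lam l C (h1 + h1') (\<lambda>i. h2 i + h2' i) (\<lambda>k. h4 k + h4' k) i),
      dual_value m l b (h1 + h1') (\<lambda>i. h2 i + h2' i) (\<lambda>k. h4 k + h4' k))"
    by (simp add: x y dual_matrix_linear dual_value_linear vec_eq_iff)
  then show "x + y \<in> ?W" using x y sym_matrices_simps(1) by blast
next
  fix r x assume "x \<in> ?W"
  then obtain h1 h2 h4 where
    x: "x = ((\<chi> i. dual_matrix lam l C h1 h2 h4 i), dual_value m l b h1 h2 h4)" "h1 \<in> sym_matrices"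
    by blast
  have "r *\<^sub>R x = ((\<chi> i. dual_matrix lam l C (r *\<^sub>R h1) (\<lambda>i. r * h2 i) (\<lambda>k. r * h4 k) i),
      dual_value m l b (r *\<^sub>R h1) (\<lambda>i. r * h2 i) (\<lambda>k. r * h4 k))"
    by (simp add: x dual_matrix_linear dual_value_linear vec_eq_iff)
  then show "r *\<^sub>R x \<in> ?W" using x sym_matrices_simps(3) by blast
qed

text \<open>The bound is tested on tuples with a multiple of \<open>outer x\<close> in position
  \<open>i\<close> and zeros elsewhere.\<close>

lemma psd_tuples_dual_bound:
  fixes g :: "real ^ 'n::finite ^ 'n ^ 'q::finite"
  assumes sym: "g $ i \<in> sym_matrices" and bound: "\<And>z. z \<in> psd_tuples \<Longrightarrow> e \<le> g \<bullet> z"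
  shows "psd (g $ i - (e / real CARD('n)) *\<^sub>R mat 1)"
  unfolding psd_def
proof (intro conjI allI)
  show "g $ i - (e / real CARD('n)) *\<^sub>R mat 1 \<in> sym_matrices"
    using sym by (intro sym_matrices_simps)
  fix x :: "real ^ 'n"
  show "0 \<le> x \<bullet> ((g $ i - (e / real CARD('n)) *\<^sub>R mat 1) *v x)"
  proof (cases "x = 0")
    case True
    then show ?thesis by simp
  next
    case False
    \<comment> \<open>Scales \<open>outer x\<close> to trace \<open>CARD('n)\<close>, as membership
      in \<open>psd_tuples\<close> demands.\<close>
    define r where "r = real CARD('n) / (x \<bullet> x)"
    have r: "0 < r" using False by (simp add: r_def)
    let ?z = "(\<chi> j. if j = i then r *\<^sub>R outer x else 0) :: real ^ 'n ^ 'n ^ 'q"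
    have "psd (0 :: real ^ 'n ^ 'n)"
      by (simp add: psd_def sym_matrices_simps)
    then have "?z \<in> psd_tuples"
      using False r
      by (simp add: psd_tuples_def psd_outer psd_scaleR if_distrib[of trace] trace_scaleR trace_outer
          r_def cong: if_cong)
    then have "e \<le> g \<bullet> ?z" by (rule bound)
    also have "\<dots> = r * (x \<bullet> (g $ i *v x))"
      by (simp add: inner_vec_def[of g] if_distrib[of "inner _"] inner_outer cong: if_cong)
    finally have "e * (x \<bullet> x) \<le> r * (x \<bullet> (g $ i *v x)) * (x \<bullet> x)"
      by (rule mult_right_mono) simp
    then have "e * (x \<bullet> x) \<le> real CARD('n) * (x \<bullet> (g $ i *v x))"
      using False by (simp add: r_def)
    then show ?thesis
      by (simp add: matrix_vector_mult_diff_rdistrib inner_diff_right scaleR_matrix_vector_assoc[symmetric]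
          field_simps)
  qed
qed

text \<open>For symmetric \<open>Z\<close>, the trace of \<open>outer v ** Z ** Z\<close> is the
  squared length of \<open>Z *v v\<close>. Symmetry of \<open>Zvar i\<close> enters through the
  unordered pairs.\<close>

lemma trace_outer_Zvar_square:
  fixes v :: "real ^ 'n::finite"
  shows "trace (mconst (outer v) ** (Zvar i ** Zvar i))
     = (\<Sum>u\<in>UNIV. (\<Sum>s\<in>UNIV. pconst (v $ s) * Zvar i $ s $ u)\<^sup>2)"
proof -
  have swap: "Upair s t = Upair t s" for s t :: 'n
    by simp
  have "trace (mconst (outer v) ** (Zvar i ** Zvar i))
      = (\<Sum>s\<in>UNIV. \<Sum>t\<in>UNIV. \<Sum>u\<in>UNIV. (pconst (v $ s) * Zvar i $ s $ u) * (pconst (v $ t) * Zvar i $ t $ u))"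
    unfolding trace_matrix_mult
    by (simp add: mconst_def outer_def matrix_matrix_mult_def Zvar_def pconst_simps sum_distrib_left
        swap ac_simps)
  also have "\<dots> = (\<Sum>s\<in>UNIV. \<Sum>u\<in>UNIV. \<Sum>t\<in>UNIV. (pconst (v $ s) * Zvar i $ s $ u) * (pconst (v $ t) * Zvar i $ t $ u))"
    by (intro sum.cong refl sum.swap)
  also have "\<dots> = (\<Sum>u\<in>UNIV. \<Sum>s\<in>UNIV. \<Sum>t\<in>UNIV. (pconst (v $ s) * Zvar i $ s $ u) * (pconst (v $ t) * Zvar i $ t $ u))"
    by (rule sum.swap)
  finally show ?thesis
    by (simp add: power2_eq_square sum_product)
qed

text \<open>Each \<open>B i\<close> splits into rank-one matrices, and each of these contributes a
  sum of squares.\<close>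

lemma sum_trace_psd_Zvar_square_SOS:
  fixes B :: "'q::finite \<Rightarrow> real ^ 'n::finite ^ 'n"
  assumes "\<And>i. psd (B i)"
  shows "(\<Sum>i\<in>UNIV. trace (mconst (B i) ** (Zvar i ** Zvar i))) \<in> SOS"
proof -
  have "\<exists>v :: 'n \<Rightarrow> real ^ 'n. B i = (\<Sum>w\<in>UNIV. outer (v w))" for i
    using psd_sum_outer[OF assms] by metis
  then obtain v :: "'q \<Rightarrow> 'n \<Rightarrow> real ^ 'n" where v: "\<And>i. B i = (\<Sum>w\<in>UNIV. outer (v i w))"
    by metis
  have "(\<Sum>i\<in>UNIV. trace (mconst (B i) ** (Zvar i ** Zvar i)))
      = (\<Sum>i\<in>UNIV. \<Sum>w\<in>UNIV. \<Sum>u\<in>UNIV. (\<Sum>s\<in>UNIV. pconst (v i w $ s) * Zvar i $ s $ u)\<^sup>2)"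
    by (simp add: v mconst_sum trace_sum_mult trace_outer_Zvar_square)
  also have "\<dots> = (\<Sum>(i, w, u)\<in>UNIV. (\<Sum>s\<in>UNIV. pconst (v i w $ s) * Zvar i $ s $ u)\<^sup>2)"
    by (simp add: sum.cartesian_product)
  also have "\<dots> \<in> SOS"
    using SOS_sum_squares[of UNIV "\<lambda>(i, w, u). \<Sum>s\<in>UNIV. pconst (v i w $ s) * Zvar i $ s $ u"]
    by (simp add: case_prod_unfold)
  finally show ?thesis .
qed

lemma R1_empty_imp_certificate:
  fixes lam :: "'q::finite \<Rightarrow> real" and C :: "nat \<Rightarrow> real ^ 'n::finite ^ 'n"
  assumes C: "\<And>k. k \<in> {1..l} \<Longrightarrow> C k \<in> sym_matrices" and empty: "R1 lam m l C b = {}"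
  shows "- 1 \<in> I1 lam m l C b + SOS"
proof -
  let ?W = "{((\<chi> i. dual_matrix lam l C h1 h2 h4 i), dual_value m l b h1 h2 h4)
     | h1 h2 h4. h1 \<in> sym_matrices}"
  have sym: "dual_matrix lam l C h1 h2 h4 i \<in> sym_matrices" if "h1 \<in> sym_matrices" for h1 h2 h4 i
    using that C by (rule dual_matrix_sym)
  have infeasible: "\<exists>(g, d)\<in>?W. g \<bullet> z \<noteq> d" if z: "z \<in> psd_tuples" for z
  proof (rule ccontr)
    assume H: "\<not> (\<exists>(g, d)\<in>?W. g \<bullet> z \<noteq> d)"
    have "(\<lambda>i. z $ i) \<in> R1 lam m l C b"
    proof (rule R1_if_dual_values)
      fix h1 :: "real ^ 'n ^ 'n" and h2 h4 assume h1: "h1 \<in> sym_matrices"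
      then have "(\<chi> i. dual_matrix lam l C h1 h2 h4 i) \<bullet> z = dual_value m l b h1 h2 h4"
        using H by blast
      then show "(\<Sum>i\<in>UNIV. trace (dual_matrix lam l C h1 h2 h4 i ** z $ i)) = dual_value m l b h1 h2 h4"
        by (simp add: inner_vec_def[of _ z] trace_mult_inner sym h1)
    qed (use z in \<open>simp add: psd_tuples_def\<close>)
    with empty show False by blast
  qed
  obtain g d c where g: "(g, d) \<in> ?W" and c: "0 < c" and bound: "\<And>z. z \<in> psd_tuples \<Longrightarrow> d + c \<le> g \<bullet> z"
    by (rule compact_convex_Farkas[OF subspace_dual compact_psd_tuples convex_psd_tuples
          psd_tuples_nonempty]) (rule infeasible, assumption, rule that)
  from g obtain h1 h2 h4 where h1: "h1 \<in> sym_matrices" and g_eq: "g = (\<chi> i. dual_matrix lam l C h1 h2 h4 i)"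
    and d: "d = dual_value m l b h1 h2 h4" by blast
  \<comment> \<open>Subtracting this multiple of the identity keeps every dual matrix semidefinite
    by \<open>psd_tuples_dual_bound\<close>, and lowers the dual value by \<open>d + c\<close>, from
    \<open>d\<close> to \<open>- c\<close>.\<close>
  define k where "k = h1 - ((d + c) / real CARD('n)) *\<^sub>R mat 1"
  define B where "B i = (1 / c) *\<^sub>R dual_matrix lam l C k h2 h4 i" for i
  have shift: "dual_matrix lam l C k h2 h4 i = g $ i - ((d + c) / real CARD('n)) *\<^sub>R mat 1" for i
    by (simp add: g_eq k_def dual_matrix_def)
  have psd: "psd (B i)" for i
    unfolding B_def shift using c bound
    by (intro psd_scaleR psd_tuples_dual_bound) (auto simp: g_eq sym h1)
  have val: "dual_value m l b k h2 h4 = - c"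
    using d by (simp add: k_def dual_value_def trace_sub trace_scaleR trace_I)
  \<comment> \<open>This factor turns the dual value \<open>- c\<close> into \<open>1\<close>, so
    that the ideal element has constant term \<open>- 1\<close>.\<close>
  let ?r = "- (1 / c)"
  have B: "dual_matrix lam l C (?r *\<^sub>R k) (\<lambda>i. ?r * h2 i) (\<lambda>j. ?r * h4 j) i = - B i" for i
    unfolding dual_matrix_linear(2) B_def by simp
  have one: "dual_value m l b (?r *\<^sub>R k) (\<lambda>i. ?r * h2 i) (\<lambda>j. ?r * h4 j) = 1"
    unfolding dual_value_linear(2) val using c by simp
  \<comment> \<open>Choosing \<open>- B i\<close> also as the multiplier of \<open>f3 i\<close>
    cancels the linear terms and leaves
    \<open>- trace (mconst (B i) ** (Zvar i ** Zvar i))\<close>.\<close>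
  define f where "f = (\<Sum>i\<in>UNIV. trace (mconst (- B i) ** Zvar i) + trace (mconst (- B i) ** f3 i)) - 1"
  have "k \<in> sym_matrices" "\<And>i. - B i \<in> sym_matrices"
    using h1 psd sym_matrices_simps(3)[of "B _" "- 1"] by (auto simp: k_def sym_matrices_simps psd_def)
  then have "f \<in> I1 lam m l C b"
    unfolding I1_iff f_def using sym_matrices_simps(3)[of k ?r]
    by (intro exI[of _ "?r *\<^sub>R k"] exI[of _ "\<lambda>i. ?r * h2 i"] exI[of _ "\<lambda>i. - B i"] exI[of _ "\<lambda>j. ?r * h4 j"])
       (simp only: B one pconst_simps simp_thms)
  from set_plus_intro[OF this sum_trace_psd_Zvar_square_SOS[OF psd]]
  have "f + (\<Sum>i\<in>UNIV. trace (mconst (B i) ** (Zvar i ** Zvar i))) \<in> I1 lam m l C b + SOS" .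
  moreover have "f + (\<Sum>i\<in>UNIV. trace (mconst (B i) ** (Zvar i ** Zvar i))) = - 1"
    by (simp add: f_def f3_def mconst_simps trace_mult_simps sum_negf sum_subtractf)
  ultimately show ?thesis by (simp only:)
qed

theorem proposition2:
  fixes lam :: "'q::finite \<Rightarrow> real" and m :: "'q \<Rightarrow> nat"
    and l :: nat and C :: "nat \<Rightarrow> real ^ 'n::finite ^ 'n" and b :: "nat \<Rightarrow> real"
  assumes "\<And>i. 0 < m i"
    and "(\<Sum>i\<in>UNIV. m i) = CARD('n)"
    and "\<And>k. k \<in> {1..l} \<Longrightarrow> C k \<in> sym_matrices"
  shows "(R1 lam m l C b \<noteq> {} \<and> - 1 \<notin> I1 lam m l C b + SOS)
       \<or> (R1 lam m l C b = {} \<and> - 1 \<in> I1 lam m l C b + SOS)"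
proof (cases "R1 lam m l C b = {}")
  case True
  with assms(3) have "- 1 \<in> I1 lam m l C b + SOS"
    by (rule R1_empty_imp_certificate)
  with True show ?thesis by blast
next
  case False
  then show ?thesis using R1_imp_no_certificate by blast
qed

end
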